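(* Let $I=[0,c]$ and let $(\alpha,\kappa):I\rightarrow\mathbb{R}^2$ be a smooth function. Then there exists a Legendre curve $(\gamma,\eta):I\rightarrow X\times S$ whose curvature is $(\alpha,\kappa)$.
   Context: Let $(X,\|\cdot\|)$ be a two-dimensional real normed space with unit circle $S=\{x\in X:\|x\|=1\}$. The plane is assumed smooth ($S$ is a smooth curve) and strictly convex ($S$ contains no line segment). Fix a nondegenerate symplectic (alternating) bilinear form $[\cdot,\cdot]$ on $X$. For $x,y\in X$, $x\dashv_B y$ (Birkhoff orthogonality) means $\|x+ty\|\ge\|x\|$ for all $t\in\mathbb{R}$. For $v\in X\setminus\{o\}$ let $b(v)\in S$ be the unique vector with $v\dashv_B b(v)$ and $[v,b(v)]>0$. A Legendre curve is a smooth map $(\gamma,\eta):I\rightarrow X\times S$ with $\eta(t)\dashv_B\gamma'(t)$ for all $t\in I$. Put $\xi(t)=b(\eta(t))$. There are smooth functions $\alpha,\kappa:I\to\mathbb{R}$ with $\gamma'(t)=\alpha(t)\xi(t)$ and $\eta'(t)=\kappa(t)\xi(t)$; the pair $(\alpha,\kappa)$ is called the curvature of the Legendre curve $(\gamma,\eta)$. *)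

theory Defs
  imports "HOL-Analysis.Analysis"
begin

(* Smooth means C^infinity throughout. D n is the n-th derivative; on a closed interval the
   derivatives at the endpoints are one-sided. *)
definition smooth_map_on :: "real set \<Rightarrow> (real \<Rightarrow> 'a::real_normed_vector) \<Rightarrow> bool" where
  "smooth_map_on I f \<longleftrightarrow>
     (\<exists>D :: nat \<Rightarrow> real \<Rightarrow> 'a.
        (\<forall>t\<in>I. D 0 t = f t) \<and>
        (\<forall>n. \<forall>t\<in>I. (D n has_vector_derivative D (Suc n) t) (at t within I)))"

(* C is the trace of a regular, smoothly closed, simple curve, parametrized periodically over
   the whole line so that it is smooth at the closing point too. *)
definition smooth_closed_curve :: "'a::real_normed_vector set \<Rightarrow> bool" where
  "smooth_closed_curve C \<longleftrightarrow>
     (\<exists>(T::real) (\<phi> :: real \<Rightarrow> 'a). T > 0 \<and> smooth_map_on UNIV \<phi> \<and>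
        (\<forall>u. vector_derivative \<phi> (at u) \<noteq> 0) \<and>
        (\<forall>u. \<phi> (u + T) = \<phi> u) \<and>
        inj_on \<phi> {0..<T} \<and> \<phi> ` {0..<T} = C)"

abbreviation unit_circle :: "'a::real_normed_vector set" where
  "unit_circle \<equiv> sphere 0 1"

definition smooth_plane :: "'a::real_normed_vector itself \<Rightarrow> bool" where
  "smooth_plane _ \<longleftrightarrow> smooth_closed_curve (unit_circle :: 'a set)"

definition strictly_convex_plane :: "'a::real_normed_vector itself \<Rightarrow> bool" where
  "strictly_convex_plane _ \<longleftrightarrow>
     (\<forall>x y :: 'a. x \<noteq> y \<longrightarrow> \<not> closed_segment x y \<subseteq> unit_circle)"

definition symplectic_form :: "('a::real_normed_vector \<Rightarrow> 'a \<Rightarrow> real) \<Rightarrow> bool" where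
  "symplectic_form \<omega> \<longleftrightarrow>
     bilinear \<omega> \<and> (\<forall>x. \<omega> x x = 0) \<and> (\<forall>x. x \<noteq> 0 \<longrightarrow> (\<exists>y. \<omega> x y \<noteq> 0))"

definition birkhoff_orthogonal :: "'a::real_normed_vector \<Rightarrow> 'a \<Rightarrow> bool" where
  "birkhoff_orthogonal x y \<longleftrightarrow> (\<forall>t::real. norm (x + t *\<^sub>R y) \<ge> norm x)"

(* Meaningful only for v \<noteq> 0 in a smooth plane, where the vector described exists and is
   unique. *)
definition birkhoff_b ::
  "('a::real_normed_vector \<Rightarrow> 'a \<Rightarrow> real) \<Rightarrow> 'a \<Rightarrow> 'a" where
  "birkhoff_b \<omega> v = (THE w. w \<in> unit_circle \<and> birkhoff_orthogonal v w \<and> \<omega> v w > 0)"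

definition legendre_curve ::
  "real set \<Rightarrow> (real \<Rightarrow> 'a::real_normed_vector) \<Rightarrow> (real \<Rightarrow> 'a) \<Rightarrow> bool" where
  "legendre_curve I \<gamma> \<eta> \<longleftrightarrow>
     smooth_map_on I (\<lambda>t. (\<gamma> t, \<eta> t)) \<and>
     (\<forall>t\<in>I. \<eta> t \<in> unit_circle) \<and>
     (\<forall>t\<in>I. birkhoff_orthogonal (\<eta> t) (vector_derivative \<gamma> (at t within I)))"

definition has_curvature ::
  "('a::real_normed_vector \<Rightarrow> 'a \<Rightarrow> real) \<Rightarrow> real set \<Rightarrow>
     (real \<Rightarrow> 'a) \<Rightarrow> (real \<Rightarrow> 'a) \<Rightarrow> (real \<Rightarrow> real) \<Rightarrow> (real \<Rightarrow> real) \<Rightarrow> bool" where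
  "has_curvature \<omega> I \<gamma> \<eta> \<alpha> \<kappa> \<longleftrightarrow>
     (\<forall>t\<in>I. (\<gamma> has_vector_derivative \<alpha> t *\<^sub>R birkhoff_b \<omega> (\<eta> t)) (at t within I) \<and>
            (\<eta> has_vector_derivative \<kappa> t *\<^sub>R birkhoff_b \<omega> (\<eta> t)) (at t within I))"

end

theory Submission
  imports Defs
begin

text \<open>
  Let \<open>\<phi>\<close> be a periodic parametrization of the unit circle that is positively oriented with
  respect to \<open>\<omega>\<close>. A point \<open>\<phi> u\<close> is Birkhoff orthogonal exactly to the multiples of the tangent
  \<open>\<phi>' u\<close> (\<open>birkhoff_orthogonal_tangent\<close>, \<open>birkhoff_orthogonal_imp_tangential\<close>), whence
  \<open>b(\<phi> u) = \<phi>' u / norm (\<phi>' u)\<close>. Writing \<open>\<eta> = \<phi>(\<theta>)\<close>, the equation \<open>\<eta>' = \<kappa> b(\<eta>)\<close> says that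
  \<open>\<theta>' norm (\<phi>'(\<theta>)) = \<kappa>\<close>: the arc length of the circle at \<open>\<theta>\<close> is an antiderivative of \<open>\<kappa>\<close>.
  The arc length is an increasing bijection of the line, so \<open>\<theta>\<close> is obtained by inverting it, and
  \<open>\<gamma>\<close> by integrating \<open>\<alpha> b(\<eta>)\<close>.

  The delicate point is that everything must be smooth to all orders, although only the curve
  \<open>\<phi>\<close>, not the norm, is given as a smooth object. The speed \<open>norm (\<phi>' u)\<close> and the vector
  \<open>b(\<phi> u)\<close> are smooth functions of \<open>u\<close> because \<open>\<phi>' u = z u \<cdot> \<phi>(m u)\<close> with a smooth
  angle-matching parameter \<open>m\<close> and a smooth factor \<open>z > 0\<close> (\<open>smooth_radial_lift\<close>, in complex
  coordinates); since \<open>\<phi>(m u)\<close> has norm \<open>1\<close>, the factor \<open>z u\<close> is the speed. Smoothness itself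
  is handled by a coinduction principle (\<open>smooth_map_on_coinduct\<close>), which reduces it to
  one-step rules of differentiation, and inverse functions are covered by the observation that they
  solve an autonomous equation.
\<close>

section \<open>Smooth functions of one real variable\<close>

text \<open>Smoothness is the greatest property of functions that is preserved by passing to some
  derivative. This form spares all higher product and chain rules: to see that an operation
  preserves smoothness, find a class of functions that contains the result and in which one
  differentiation is always possible.\<close>

lemma smooth_map_on_coinduct:
  assumes "P f"
    and step: "\<And>g. P g \<Longrightarrow> \<exists>g'. P g' \<and> (\<forall>t\<in>I. (g has_vector_derivative g' t) (at t within I))"
  shows "smooth_map_on I f"
proof -
  obtain d where d: "\<And>g. P g \<Longrightarrow> P (d g) \<and> (\<forall>t\<in>I. (g has_vector_derivative d g t) (at t within I))"
    using step by metis
  define D where "D n = (d ^^ n) f" for n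
  have P: "P (D n)" for n
    by (induction n) (use assms(1) d in \<open>auto simp: D_def\<close>)
  show ?thesis
    unfolding smooth_map_on_def
    by (rule exI[of _ D]) (use P d in \<open>auto simp: D_def\<close>)
qed

lemma smooth_map_onE:
  assumes "smooth_map_on I f"
  obtains D where "\<And>t. t \<in> I \<Longrightarrow> D 0 t = f t"
    and "\<And>n t. t \<in> I \<Longrightarrow> (D n has_vector_derivative D (Suc n) t) (at t within I)"
  using assms unfolding smooth_map_on_def by blast

lemma smooth_map_on_derivative:
  assumes "smooth_map_on I f"
  obtains f' where "smooth_map_on I f'"
    and "\<And>t. t \<in> I \<Longrightarrow> (f has_vector_derivative f' t) (at t within I)"
proof -
  obtain D where D0: "\<And>t. t \<in> I \<Longrightarrow> D 0 t = f t"
    and D: "\<And>n t. t \<in> I \<Longrightarrow> (D n has_vector_derivative D (Suc n) t) (at t within I)"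
    using smooth_map_onE[OF assms(1)] by blast
  show ?thesis
  proof (rule that[of "D 1"])
    show "smooth_map_on I (D 1)"
      unfolding smooth_map_on_def by (rule exI[of _ "\<lambda>n. D (Suc n)"]) (simp add: D)
    show "(f has_vector_derivative D 1 t) (at t within I)" if "t \<in> I" for t
      by (rule has_vector_derivative_transform[OF that, of f "D 0"])
         (use D0 D[OF that, of 0] in auto)
  qed
qed

lemma smooth_map_on_antiderivative:
  assumes "smooth_map_on I f"
    and "\<And>t. t \<in> I \<Longrightarrow> (F has_vector_derivative f t) (at t within I)"
  shows "smooth_map_on I F"
proof -
  obtain D where D0: "\<And>t. t \<in> I \<Longrightarrow> D 0 t = f t"
    and D: "\<And>n t. t \<in> I \<Longrightarrow> (D n has_vector_derivative D (Suc n) t) (at t within I)"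
    using smooth_map_onE[OF assms(1)] by blast
  show ?thesis
    unfolding smooth_map_on_def
    by (rule exI[of _ "case_nat F D"]) (auto simp: D D0 assms split: nat.split)
qed

lemma smooth_map_on_imp_continuous_on:
  assumes "smooth_map_on I f" shows "continuous_on I f"
  by (rule smooth_map_on_derivative[OF assms])
     (meson continuous_on_eq_continuous_within has_vector_derivative_continuous)

lemma smooth_map_on_bounded_linear:
  assumes "bounded_linear h" and "smooth_map_on I f"
  shows "smooth_map_on I (\<lambda>t. h (f t))"
proof -
  obtain D where "\<And>t. t \<in> I \<Longrightarrow> D 0 t = f t"
    and "\<And>n t. t \<in> I \<Longrightarrow> (D n has_vector_derivative D (Suc n) t) (at t within I)"
    using smooth_map_onE[OF assms(2)] by blast
  then show ?thesis
    unfolding smooth_map_on_def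
    by (intro exI[of _ "\<lambda>n t. h (D n t)"])
       (auto intro: bounded_linear.has_vector_derivative[OF assms(1)])
qed

lemma smooth_map_on_Pair:
  assumes "smooth_map_on I f" and "smooth_map_on I g"
  shows "smooth_map_on I (\<lambda>t. (f t, g t))"
proof -
  obtain D where "\<And>t. t \<in> I \<Longrightarrow> D 0 t = f t"
    and "\<And>n t. t \<in> I \<Longrightarrow> (D n has_vector_derivative D (Suc n) t) (at t within I)"
    using smooth_map_onE[OF assms(1)] by blast
  moreover obtain E where "\<And>t. t \<in> I \<Longrightarrow> E 0 t = g t"
    and "\<And>n t. t \<in> I \<Longrightarrow> (E n has_vector_derivative E (Suc n) t) (at t within I)"
    using smooth_map_onE[OF assms(2)] by blast
  ultimately show ?thesis
    unfolding smooth_map_on_def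
    by (intro exI[of _ "\<lambda>n t. (D n t, E n t)"]) (auto intro: has_vector_derivative_Pair)
qed

lemma smooth_map_on_const: "smooth_map_on I (\<lambda>_. k)"
  by (rule smooth_map_on_coinduct[where P = "\<lambda>f. \<exists>k. f = (\<lambda>_. k)"])
     (auto intro!: has_vector_derivative_const)

lemma smooth_map_on_ident: "smooth_map_on I (\<lambda>t::real. t)"
  by (rule smooth_map_on_antiderivative[OF smooth_map_on_const[of _ 1]])
     (rule has_vector_derivative_id)

lemma smooth_map_on_reflect:
  assumes "smooth_map_on UNIV f"
  shows "smooth_map_on UNIV (\<lambda>t. f (- t))"
proof -
  obtain D where D0: "\<And>t. D 0 t = f t"
    and D: "\<And>n t. (D n has_vector_derivative D (Suc n) t) (at t)"
    using assms unfolding smooth_map_on_def by auto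
  have "((\<lambda>t. (-1) ^ n *\<^sub>R D n (- t)) has_vector_derivative (-1) ^ Suc n *\<^sub>R D (Suc n) (- t)) (at t)" for n t
  proof -
    have "((D n \<circ> uminus) has_vector_derivative (-1) *\<^sub>R D (Suc n) (- t)) (at t)"
      by (rule vector_diff_chain_at) (auto intro!: derivative_eq_intros D)
    then have "((\<lambda>t. (-1) ^ n *\<^sub>R (D n \<circ> uminus) t) has_vector_derivative (-1) ^ n *\<^sub>R ((-1) *\<^sub>R D (Suc n) (- t))) (at t)"
      by (intro bounded_linear.has_vector_derivative[OF bounded_linear_scaleR_right])
    then show ?thesis by (simp add: o_def)
  qed
  then show ?thesis
    unfolding smooth_map_on_def
    by (intro exI[of _ "\<lambda>n t. (-1) ^ n *\<^sub>R D n (- t)"]) (auto simp: D0)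
qed

text \<open>The class fed to the coinduction principle: its members need not be smooth a priori, but the
  rules of differentiation turn every expression into another one. In a composition the outer
  function is smooth on the whole line, so the range of the inner one need not be tracked.\<close>

inductive smooth_expression :: "real set \<Rightarrow> (real \<Rightarrow> 'b::real_normed_field) \<Rightarrow> bool"
  for I where
  base: "smooth_map_on I f \<Longrightarrow> smooth_expression I f"
| add: "smooth_expression I f \<Longrightarrow> smooth_expression I g \<Longrightarrow> smooth_expression I (\<lambda>t. f t + g t)"
| mult: "smooth_expression I f \<Longrightarrow> smooth_expression I g \<Longrightarrow> smooth_expression I (\<lambda>t. f t * g t)"
| inverse: "smooth_expression I f \<Longrightarrow> \<forall>t\<in>I. f t \<noteq> 0 \<Longrightarrow> smooth_expression I (\<lambda>t. inverse (f t))"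
| compose: "smooth_map_on I h \<Longrightarrow> smooth_map_on UNIV g \<Longrightarrow> smooth_expression I (\<lambda>t. g (h t))"

lemma smooth_expression_derivative:
  assumes "smooth_expression I f"
  shows "\<exists>f'. smooth_expression I f' \<and> (\<forall>t\<in>I. (f has_vector_derivative f' t) (at t within I))"
  using assms
proof (induction rule: smooth_expression.induct)
  case (base f)
  then show ?case by (meson smooth_map_on_derivative smooth_expression.base)
next
  case (add f g)
  then obtain f' g' where "smooth_expression I f'" "smooth_expression I g'"
    "\<forall>t\<in>I. (f has_vector_derivative f' t) (at t within I)"
    "\<forall>t\<in>I. (g has_vector_derivative g' t) (at t within I)" by auto
  then show ?case
    by (intro exI[of _ "\<lambda>t. f' t + g' t"])
       (auto intro: smooth_expression.add has_vector_derivative_add)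
next
  case (mult f g)
  then obtain f' g' where "smooth_expression I f'" "smooth_expression I g'"
    "\<forall>t\<in>I. (f has_vector_derivative f' t) (at t within I)"
    "\<forall>t\<in>I. (g has_vector_derivative g' t) (at t within I)" by auto
  then show ?case using mult
    by (intro exI[of _ "\<lambda>t. f t * g' t + f' t * g t"])
       (auto intro: smooth_expression.intros has_vector_derivative_mult)
next
  case (inverse f)
  then obtain f' where f': "smooth_expression I f'"
    "\<forall>t\<in>I. (f has_vector_derivative f' t) (at t within I)" by auto
  have "((\<lambda>t. inverse (f t)) has_vector_derivative
      (- 1) * (inverse (f t) * f' t * inverse (f t))) (at t within I)" if "t \<in> I" for t
    using Deriv.has_derivative_inverse[OF bspec[OF inverse(2) that]
        bspec[OF f'(2) that, unfolded has_vector_derivative_def]]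
    unfolding has_vector_derivative_def by (simp add: algebra_simps)
  moreover have "smooth_expression I (\<lambda>t. (- 1) * (inverse (f t) * f' t * inverse (f t)))"
    by (intro smooth_expression.mult smooth_expression.inverse inverse f'
        smooth_expression.base[OF smooth_map_on_const])
  ultimately show ?case by blast
next
  case (compose h g)
  obtain h' where h': "smooth_map_on I h'"
    "\<And>t. t \<in> I \<Longrightarrow> (h has_vector_derivative h' t) (at t within I)"
    using smooth_map_on_derivative[OF compose(1)] by blast
  obtain g' where g': "smooth_map_on UNIV g'" "\<And>t. (g has_vector_derivative g' t) (at t)"
    using smooth_map_on_derivative[OF compose(2)] by auto
  have "((g \<circ> h) has_vector_derivative h' t *\<^sub>R g' (h t)) (at t within I)" if "t \<in> I" for t
    by (rule vector_diff_chain_within[OF h'(2)[OF that]])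
       (use g'(2) in \<open>auto intro: has_vector_derivative_at_within\<close>)
  then have "\<forall>t\<in>I. ((\<lambda>t. g (h t)) has_vector_derivative of_real (h' t) * g' (h t)) (at t within I)"
    by (simp add: o_def scaleR_conv_of_real)
  moreover have "smooth_expression I (\<lambda>t. of_real (h' t) * g' (h t))"
    by (intro smooth_expression.mult smooth_expression.compose compose(1) g'(1)
        smooth_expression.base[OF smooth_map_on_bounded_linear[OF bounded_linear_of_real h'(1)]])
  ultimately show ?case by blast
qed

lemma smooth_expression_imp_smooth:
  "smooth_expression I f \<Longrightarrow> smooth_map_on I f"
  by (rule smooth_map_on_coinduct[where P = "smooth_expression I", OF _ smooth_expression_derivative])

lemma smooth_map_on_mult:
  fixes f g :: "real \<Rightarrow> 'b::real_normed_field"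
  assumes "smooth_map_on I f" "smooth_map_on I g"
  shows "smooth_map_on I (\<lambda>t. f t * g t)"
  by (rule smooth_expression_imp_smooth) (intro smooth_expression.mult smooth_expression.base assms)

lemma smooth_map_on_add:
  fixes f g :: "real \<Rightarrow> 'b::real_normed_field"
  assumes "smooth_map_on I f" "smooth_map_on I g"
  shows "smooth_map_on I (\<lambda>t. f t + g t)"
  by (rule smooth_expression_imp_smooth) (intro smooth_expression.add smooth_expression.base assms)

lemma smooth_map_on_inverse:
  fixes f :: "real \<Rightarrow> 'b::real_normed_field"
  assumes "smooth_map_on I f" "\<And>t. t \<in> I \<Longrightarrow> f t \<noteq> 0"
  shows "smooth_map_on I (\<lambda>t. inverse (f t))"
  by (rule smooth_expression_imp_smooth[OF smooth_expression.inverse[OF smooth_expression.base]]) (use assms in auto)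

lemma smooth_map_on_divide:
  fixes f g :: "real \<Rightarrow> 'b::real_normed_field"
  assumes "smooth_map_on I f" "smooth_map_on I g" "\<And>t. t \<in> I \<Longrightarrow> g t \<noteq> 0"
  shows "smooth_map_on I (\<lambda>t. f t / g t)"
  unfolding divide_inverse by (rule smooth_map_on_mult[OF assms(1) smooth_map_on_inverse[OF assms(2,3)]])

lemma smooth_map_on_compose:
  fixes g :: "real \<Rightarrow> 'b::real_normed_field"
  assumes "smooth_map_on UNIV g" "smooth_map_on I h"
  shows "smooth_map_on I (\<lambda>t. g (h t))"
  by (rule smooth_expression_imp_smooth[OF smooth_expression.compose[OF assms(2,1)]])

text \<open>A solution of \<open>g' = h(g)\<close> with smooth \<open>h\<close> inherits smoothness: the functions of the form
  \<open>H(g)\<close> with \<open>H\<close> smooth are closed under differentiation, since \<open>(H(g))' = (h H')(g)\<close>.\<close>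

lemma smooth_map_on_autonomous:
  fixes g h :: "real \<Rightarrow> real"
  assumes h: "smooth_map_on UNIV h"
    and g: "\<And>t. t \<in> I \<Longrightarrow> (g has_vector_derivative h (g t)) (at t within I)"
  shows "smooth_map_on I g"
proof (rule smooth_map_on_coinduct[where P = "\<lambda>f. \<exists>H. smooth_map_on UNIV H \<and> f = (\<lambda>t. H (g t))"])
  show "\<exists>H. smooth_map_on UNIV H \<and> g = (\<lambda>t. H (g t))"
    using smooth_map_on_ident by (intro exI[of _ "\<lambda>t. t"]) auto
next
  fix f :: "real \<Rightarrow> real"
  assume "\<exists>H. smooth_map_on UNIV H \<and> f = (\<lambda>t. H (g t))"
  then obtain H where H: "smooth_map_on UNIV H" "f = (\<lambda>t. H (g t))" by auto
  obtain H' where H': "smooth_map_on UNIV H'" "\<And>t. (H has_vector_derivative H' t) (at t)"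
    using smooth_map_on_derivative[OF H(1)] by auto
  have "((H \<circ> g) has_vector_derivative h (g t) *\<^sub>R H' (g t)) (at t within I)" if "t \<in> I" for t
    by (rule vector_diff_chain_within[OF g[OF that]])
       (use H'(2) in \<open>auto intro: has_vector_derivative_at_within\<close>)
  then show "\<exists>f'. (\<exists>H. smooth_map_on UNIV H \<and> f' = (\<lambda>t. H (g t))) \<and>
      (\<forall>t\<in>I. (f has_vector_derivative f' t) (at t within I))"
    unfolding H(2) o_def
    by (intro exI[of _ "\<lambda>t. h (g t) * H' (g t)"] conjI exI[of _ "\<lambda>u. h u * H' u"])
       (auto intro: smooth_map_on_mult h H'(1))
qed

lemma smooth_antiderivative_UNIV:
  fixes f :: "real \<Rightarrow> 'b::euclidean_space"
  assumes "smooth_map_on UNIV f"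
  obtains F where "smooth_map_on UNIV F" "\<And>t. (F has_vector_derivative f t) (at t)"
proof -
  have "continuous_on UNIV f" using assms by (rule smooth_map_on_imp_continuous_on)
  then have "\<exists>F. \<forall>x::real. - \<infinity> < x \<longrightarrow> x < \<infinity> \<longrightarrow> (F has_vector_derivative f x) (at x)"
    by (intro einterval_antiderivative) (auto simp: continuous_on_eq_continuous_at)
  then obtain F where "\<And>t. (F has_vector_derivative f t) (at t)" by auto
  then show ?thesis
    using that smooth_map_on_antiderivative[OF assms] by auto
qed

lemma smooth_antiderivative_Icc:
  fixes f :: "real \<Rightarrow> 'b::banach"
  assumes "smooth_map_on {a..b} f"
  obtains F where "smooth_map_on {a..b} F"
    "\<And>t. t \<in> {a..b} \<Longrightarrow> (F has_vector_derivative f t) (at t within {a..b})"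
  using antiderivative_continuous[OF smooth_map_on_imp_continuous_on[OF assms]]
    smooth_map_on_antiderivative[OF assms] by metis

text \<open>Since \<open>h'\<close> is periodic and positive, \<open>h\<close> gains the same positive amount over every period, so
  it maps the line onto itself. Its inverse solves the autonomous equation \<open>g' = 1 / h'(g)\<close> and
  is therefore smooth. This is used both for the direction angle and for the arc length of the
  unit circle.\<close>

lemma smooth_inverse_of_periodic_derivative:
  fixes h h' :: "real \<Rightarrow> real"
  assumes h': "smooth_map_on UNIV h'"
    and deriv: "\<And>t. (h has_vector_derivative h' t) (at t)"
    and pos: "\<And>t. h' t > 0"
    and T: "T > 0" "\<And>t. h' (t + T) = h' t"
  obtains g where "smooth_map_on UNIV g" "\<And>t. h (g t) = t" "\<And>t. g (h t) = t"
    "\<And>t. (g has_vector_derivative inverse (h' (g t))) (at t)"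
proof -
  have der: "(h has_real_derivative h' t) (at t)" for t
    using deriv by (simp add: has_real_derivative_iff_has_vector_derivative)
  have mono: "h s < h t" if "s < t" for s t
    using DERIV_pos_imp_increasing[OF that] der pos by blast
  have cont: "continuous_on A h" for A
    using der by (meson DERIV_continuous_on DERIV_subset subset_UNIV)
  define A where "A = h T - h 0"
  have "A > 0" using mono T(1) by (simp add: A_def)
  have shift: "h (t + T) = h t + A" for t
  proof -
    have "((\<lambda>t. h (t + T) - h t) has_real_derivative 0) (at t)" for t
      using DERIV_diff[OF DERIV_shift[THEN iffD1, OF der[of "t + T"]] der[of t]] by (simp add: T(2))
    then have "h (t + T) - h t = h (0 + T) - h 0"
      using DERIV_isconst_all[of "\<lambda>t. h (t + T) - h t"] by blast
    then show ?thesis by (simp add: A_def)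
  qed
  have up: "h (real n * T) = h 0 + real n * A" for n
  proof (induction n)
    case (Suc n)
    then show ?case using shift[of "real n * T"] by (simp add: algebra_simps)
  qed simp
  have down: "h (- (real n * T)) = h 0 - real n * A" for n
  proof (induction n)
    case (Suc n)
    then show ?case using shift[of "- (real (Suc n) * T)"] by (simp add: algebra_simps)
  qed simp
  have "\<exists>s. h s = t" for t
  proof -
    obtain n where n: "real n * A > \<bar>t - h 0\<bar>"
      using \<open>A > 0\<close> ex_less_of_nat_mult by blast
    have "h (- (real n * T)) \<le> t" "t \<le> h (real n * T)"
      using n up[of n] down[of n] by linarith+
    moreover have "- (real n * T) \<le> real n * T" using T(1) by simp
    ultimately show ?thesis using IVT'[OF _ _ _ cont] by blast
  qed
  then obtain g where hg: "\<And>t. h (g t) = t" by metis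
  have gh: "g (h s) = s" for s
    using mono hg by (metis less_irrefl linorder_cases)
  have "(g has_derivative (\<lambda>x. inverse (h' s) * x)) (at (h s))" for s
  proof (rule has_derivative_inverse_strong[OF open_UNIV UNIV_I cont gh])
    show "(h has_derivative (\<lambda>x. h' s * x)) (at s)"
      using der by (simp add: has_field_derivative_def)
    show "(\<lambda>x. h' s * x) \<circ> (\<lambda>x. inverse (h' s) * x) = id"
      using pos[of s] by (auto simp: fun_eq_iff)
  qed
  then have "(g has_real_derivative inverse (h' s)) (at (h s))" for s
    by (simp add: has_field_derivative_def)
  then have dg: "(g has_vector_derivative inverse (h' (g t))) (at t)" for t
    by (metis hg has_real_derivative_iff_has_vector_derivative)
  have "smooth_map_on UNIV g"
    by (rule smooth_map_on_autonomous[of "\<lambda>s. inverse (h' s)"])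
       (use dg pos in \<open>auto intro!: smooth_map_on_inverse h' simp: less_imp_neq[THEN not_sym]\<close>)
  then show ?thesis using that hg gh dg by blast
qed

section \<open>Birkhoff orthogonality and tangents of the unit circle\<close>

lemma has_vector_derivative_remainder:
  assumes "(f has_vector_derivative v) (at u)" and "e > 0"
  obtains d where "d > 0" and "\<And>h. \<bar>h\<bar> < d \<Longrightarrow> norm (f (u + h) - f u - h *\<^sub>R v) \<le> e * \<bar>h\<bar>"
proof -
  obtain d where "d > 0" and
    d: "\<And>y. norm (y - u) < d \<Longrightarrow> norm (f y - f u - (y - u) *\<^sub>R v) \<le> e * norm (y - u)"
    using assms unfolding has_vector_derivative_def has_derivative_at_alt by blast
  show ?thesis
    by (rule that[OF \<open>d > 0\<close>]) (use d[of "u + h" for h] in auto)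
qed

lemma birkhoff_orthogonal_scaleR:
  "birkhoff_orthogonal x y \<Longrightarrow> birkhoff_orthogonal x (k *\<^sub>R y)"
  unfolding birkhoff_orthogonal_def by simp

text \<open>If some \<open>\<phi> u + t v\<close> were inside the unit disc, convexity would push the tangent line below norm
  \<open>1\<close> at a linear rate near \<open>\<phi> u\<close>, whereas the curve, which stays at norm \<open>1\<close>, differs
  from its tangent only to higher order.\<close>

lemma birkhoff_orthogonal_tangent:
  fixes \<phi> :: "real \<Rightarrow> 'a::real_normed_vector"
  assumes unit: "\<And>s. norm (\<phi> s) = 1"
    and deriv: "(\<phi> has_vector_derivative v) (at u)"
  shows "birkhoff_orthogonal (\<phi> u) v"
  unfolding birkhoff_orthogonal_def
proof (rule allI, rule ccontr)
  fix t :: real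
  assume "\<not> norm (\<phi> u + t *\<^sub>R v) \<ge> norm (\<phi> u)"
  then have less: "norm (\<phi> u + t *\<^sub>R v) < 1" by (simp add: unit)
  then have "t \<noteq> 0" using unit[of u] by auto
  define e where "e = 1 - norm (\<phi> u + t *\<^sub>R v)"
  have "e > 0" using less by (simp add: e_def)
  obtain d where "d > 0" and
    d: "\<And>h. \<bar>h\<bar> < d \<Longrightarrow> norm (\<phi> (u + h) - \<phi> u - h *\<^sub>R v) \<le> e / (2 * \<bar>t\<bar>) * \<bar>h\<bar>"
    using has_vector_derivative_remainder[OF deriv, of "e / (2 * \<bar>t\<bar>)"] \<open>e > 0\<close> \<open>t \<noteq> 0\<close> by auto
  define s where "s = min 1 (d / (2 * \<bar>t\<bar>))"
  have s: "0 < s" "s \<le> 1" using \<open>d > 0\<close> \<open>t \<noteq> 0\<close> by (auto simp: s_def)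
  have "s * \<bar>t\<bar> \<le> d / (2 * \<bar>t\<bar>) * \<bar>t\<bar>"
    by (rule mult_right_mono) (auto simp: s_def)
  also have "\<dots> < d" using \<open>d > 0\<close> \<open>t \<noteq> 0\<close> by simp
  finally have "\<bar>s * t\<bar> < d" using s by (simp add: abs_mult)
  have rem: "norm (\<phi> (u + s * t) - \<phi> u - (s * t) *\<^sub>R v) \<le> s * e / 2"
    using d[OF \<open>\<bar>s * t\<bar> < d\<close>] s \<open>t \<noteq> 0\<close> by (simp add: abs_mult field_simps)
  have "\<phi> u + (s * t) *\<^sub>R v = (1 - s) *\<^sub>R \<phi> u + s *\<^sub>R (\<phi> u + t *\<^sub>R v)"
    by (simp add: algebra_simps)
  also have "norm \<dots> \<le> norm ((1 - s) *\<^sub>R \<phi> u) + norm (s *\<^sub>R (\<phi> u + t *\<^sub>R v))"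
    by (rule norm_triangle_ineq)
  also have "\<dots> = (1 - s) * 1 + s * (1 - e)"
    using s unit by (simp add: e_def)
  finally have "norm (\<phi> u + (s * t) *\<^sub>R v) \<le> 1 - s * e" by (simp add: algebra_simps)
  moreover have "norm (\<phi> (u + s * t)) \<le>
      norm (\<phi> u + (s * t) *\<^sub>R v) + norm (\<phi> (u + s * t) - \<phi> u - (s * t) *\<^sub>R v)"
    using norm_triangle_ineq[of "\<phi> u + (s * t) *\<^sub>R v" "\<phi> (u + s * t) - \<phi> u - (s * t) *\<^sub>R v"] by simp
  moreover have "s * e > 0" using s \<open>e > 0\<close> by simp
  ultimately show False using rem unit[of "u + s * t"] by linarith
qed

text \<open>The curve \<open>(1 + s a) \<phi>(u + s d)\<close> has velocity \<open>a \<phi> u + d v\<close> at \<open>s = 0\<close>, and its norm is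
  exactly \<open>|1 + s a|\<close>. For small \<open>s\<close> of the sign opposite to \<open>a\<close> that norm falls below \<open>1\<close>
  linearly, and so does the norm on the line through \<open>\<phi> u\<close> in this direction. Smoothness of
  the unit circle thus leaves a single Birkhoff orthogonal line.\<close>

lemma birkhoff_orthogonal_imp_tangential:
  fixes \<phi> :: "real \<Rightarrow> 'a::real_normed_vector"
  assumes unit: "\<And>s. norm (\<phi> s) = 1"
    and deriv: "(\<phi> has_vector_derivative v) (at u)"
    and orth: "birkhoff_orthogonal (\<phi> u) (a *\<^sub>R \<phi> u + d *\<^sub>R v)"
  shows "a = 0"
proof (rule ccontr)
  assume "a \<noteq> 0"
  define p where "p s = (1 + s * a) *\<^sub>R \<phi> (u + s * d)" for s
  have "((\<phi> \<circ> (\<lambda>s. u + s * d)) has_vector_derivative d *\<^sub>R v) (at 0)"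
    by (rule vector_diff_chain_at) (auto intro!: derivative_eq_intros deriv)
  then have "(p has_vector_derivative a *\<^sub>R \<phi> u + d *\<^sub>R v) (at 0)"
    unfolding p_def o_def by (auto intro!: derivative_eq_intros)
  then obtain \<delta> where "\<delta> > 0" and
    \<delta>: "\<And>s. \<bar>s\<bar> < \<delta> \<Longrightarrow> norm (p s - \<phi> u - s *\<^sub>R (a *\<^sub>R \<phi> u + d *\<^sub>R v)) \<le> \<bar>a\<bar> / 2 * \<bar>s\<bar>"
    using has_vector_derivative_remainder[of p "a *\<^sub>R \<phi> u + d *\<^sub>R v" 0 "\<bar>a\<bar> / 2"] \<open>a \<noteq> 0\<close>
    by (auto simp: p_def)
  \<comment> \<open>Step towards the side where the curve enters the disc, short enough that \<open>1 + s
    a\<close> stays nonnegative.\<close>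
  define r where "r = min (\<delta> / 2) (1 / \<bar>a\<bar>)"
  define s where "s = - sgn a * r"
  have r: "0 < r" "r < \<delta>" using \<open>\<delta> > 0\<close> \<open>a \<noteq> 0\<close> by (auto simp: r_def)
  have "r * \<bar>a\<bar> \<le> 1 / \<bar>a\<bar> * \<bar>a\<bar>" by (rule mult_right_mono) (auto simp: r_def)
  then have "r * \<bar>a\<bar> \<le> 1" using \<open>a \<noteq> 0\<close> by simp
  have sa: "s * a = - (r * \<bar>a\<bar>)"
    by (simp add: s_def abs_sgn mult.commute mult.left_commute)
  have "\<bar>s\<bar> = r" using r \<open>a \<noteq> 0\<close> by (simp add: s_def abs_mult)
  have np: "norm (p s) = 1 - r * \<bar>a\<bar>" using \<open>r * \<bar>a\<bar> \<le> 1\<close> unit by (simp add: p_def sa)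
  let ?w = "a *\<^sub>R \<phi> u + d *\<^sub>R v"
  have "1 \<le> norm (\<phi> u + s *\<^sub>R ?w)"
    using orth unit unfolding birkhoff_orthogonal_def by metis
  also have "\<dots> \<le> norm (p s) + norm (p s - \<phi> u - s *\<^sub>R ?w)"
    using norm_triangle_ineq4[of "p s" "p s - \<phi> u - s *\<^sub>R ?w"] by (simp add: algebra_simps)
  also have "\<dots> \<le> 1 - r * \<bar>a\<bar> + \<bar>a\<bar> / 2 * r"
    using \<delta>[of s] \<open>\<bar>s\<bar> = r\<close> r np by (intro add_mono) simp_all
  also have "\<dots> = 1 - r * \<bar>a\<bar> / 2" by (simp add: field_simps)
  also have "\<dots> < 1" using r \<open>a \<noteq> 0\<close> by simp
  finally show False by simp
qed

lemma birkhoff_orthogonal_independent: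
  assumes "birkhoff_orthogonal x v" "x \<noteq> 0" "v \<noteq> 0"
  shows "x \<noteq> v" "independent {x, v}"
proof -
  have "x \<notin> span {v}"
  proof
    assume "x \<in> span {v}"
    then obtain k where "x = k *\<^sub>R v" by (auto simp: span_singleton)
    then have "norm (x + (- k) *\<^sub>R v) = 0" by simp
    then have "norm x \<le> 0"
      using assms(1) unfolding birkhoff_orthogonal_def by (metis (no_types))
    then show False using assms(2) by simp
  qed
  then show "x \<noteq> v" "independent {x, v}"
    using assms by (auto simp: independent_insert span_base)
qed

lemma birkhoff_orthogonal_spans_plane:
  fixes x v :: "'a::real_normed_vector"
  assumes dim: "dim (UNIV :: 'a set) = 2"
    and "birkhoff_orthogonal x v" "x \<noteq> 0" "v \<noteq> 0"
  obtains a d where "y = a *\<^sub>R x + d *\<^sub>R v"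
proof -
  obtain B where B: "{x, v} \<subseteq> B" "independent B" "UNIV \<subseteq> span B"
    using maximal_independent_subset_extend[of "{x, v}" UNIV] birkhoff_orthogonal_independent[OF assms(2-4)]
    by auto
  have "card B = 2" using dim dim_eq_card[OF _ B(2), of UNIV] B(3) by (simp add: top.extremum_unique)
  then have "B = {x, v}"
    using B(1) birkhoff_orthogonal_independent(1)[OF assms(2-4)] card_subset_eq[of B "{x, v}"]
    by (simp add: card_ge_0_finite)
  then have "y \<in> span {x, v}" using B(3) by blast
  then obtain a where "y - a *\<^sub>R x \<in> span {v}" unfolding span_breakdown_eq by blast
  then obtain d where "y - a *\<^sub>R x = d *\<^sub>R v" unfolding span_singleton by blast
  then have "y = a *\<^sub>R x + d *\<^sub>R v" by (metis add.commute diff_add_cancel)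
  then show ?thesis by (rule that)
qed

lemma symplectic_form_simps:
  assumes "symplectic_form \<omega>"
  shows "\<omega> (x + y) z = \<omega> x z + \<omega> y z" "\<omega> x (y + z) = \<omega> x y + \<omega> x z"
    "\<omega> (k *\<^sub>R x) y = k * \<omega> x y" "\<omega> x (k *\<^sub>R y) = k * \<omega> x y"
    "\<omega> x x = 0" "\<omega> x y = - \<omega> y x"
proof -
  have b: "bilinear \<omega>" and a: "\<And>x. \<omega> x x = 0"
    using assms by (auto simp: symplectic_form_def)
  show add: "\<omega> (x + y) z = \<omega> x z + \<omega> y z" "\<omega> x (y + z) = \<omega> x y + \<omega> x z" for x y z
    by (simp_all add: bilinear_ladd[OF b] bilinear_radd[OF b])
  show "\<omega> (k *\<^sub>R x) y = k * \<omega> x y" "\<omega> x (k *\<^sub>R y) = k * \<omega> x y"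
    by (simp_all add: bilinear_lmul[OF b] bilinear_rmul[OF b])
  show "\<omega> x x = 0" by (rule a)
  show "\<omega> x y = - \<omega> y x" using a[of "x + y"] a[of x] a[of y] by (simp add: add)
qed

lemma symplectic_form_birkhoff_nonzero:
  fixes x v :: "'a::real_normed_vector"
  assumes "dim (UNIV :: 'a set) = 2" "symplectic_form \<omega>"
    and "birkhoff_orthogonal x v" "x \<noteq> 0" "v \<noteq> 0"
  shows "\<omega> x v \<noteq> 0"
proof
  assume 0: "\<omega> x v = 0"
  obtain y where y: "\<omega> x y \<noteq> 0" using assms(2,4) by (auto simp: symplectic_form_def)
  obtain a d where "y = a *\<^sub>R x + d *\<^sub>R v"
    using birkhoff_orthogonal_spans_plane[OF assms(1,3-5)] .
  then show False using y 0 by (simp add: symplectic_form_simps(1-5)[OF assms(2)])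
qed

text \<open>Existence and uniqueness behind the definite description: the normalized tangent qualifies,
  and any competitor has no radial component and the same orientation.\<close>

lemma birkhoff_b_eq_unit_tangent:
  fixes \<phi> :: "real \<Rightarrow> 'a::real_normed_vector"
  assumes dim: "dim (UNIV :: 'a set) = 2" and \<omega>: "symplectic_form \<omega>"
    and unit: "\<And>s. norm (\<phi> s) = 1"
    and deriv: "(\<phi> has_vector_derivative v) (at u)"
    and pos: "\<omega> (\<phi> u) v > 0"
  shows "birkhoff_b \<omega> (\<phi> u) = (1 / norm v) *\<^sub>R v"
  unfolding birkhoff_b_def
proof (rule the_equality)
  note \<omega>_simps = symplectic_form_simps(1-5)[OF \<omega>]
  have "v \<noteq> 0" using pos \<omega>_simps(4)[of "\<phi> u" 0 v] by fastforce
  have orth: "birkhoff_orthogonal (\<phi> u) v"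
    using unit deriv by (rule birkhoff_orthogonal_tangent)
  show "(1 / norm v) *\<^sub>R v \<in> unit_circle \<and> birkhoff_orthogonal (\<phi> u) ((1 / norm v) *\<^sub>R v) \<and>
      \<omega> (\<phi> u) ((1 / norm v) *\<^sub>R v) > 0"
    using \<open>v \<noteq> 0\<close> pos birkhoff_orthogonal_scaleR[OF orth] by (simp add: \<omega>_simps)
  fix w
  assume w: "w \<in> unit_circle \<and> birkhoff_orthogonal (\<phi> u) w \<and> \<omega> (\<phi> u) w > 0"
  have "\<phi> u \<noteq> 0" using unit[of u] by auto
  then obtain a d where ad: "w = a *\<^sub>R \<phi> u + d *\<^sub>R v"
    using birkhoff_orthogonal_spans_plane[OF dim orth _ \<open>v \<noteq> 0\<close>] by blast
  then have "a = 0"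
    using birkhoff_orthogonal_imp_tangential[OF unit deriv] w by blast
  then have "w = d *\<^sub>R v" using ad by simp
  moreover from this have "d > 0" using w pos by (simp add: \<omega>_simps zero_less_mult_iff)
  moreover have "norm w = 1" using w by simp
  ultimately show "w = (1 / norm v) *\<^sub>R v" using \<open>v \<noteq> 0\<close> by (simp add: field_simps)
qed

text \<open>The plane carries only its norm, so continuity of coordinates and of the symplectic form has to
  come from somewhere. Birkhoff orthogonality of the basis provides it:
  \<open>norm (a x + d v) \<ge> |a|\<close> bounds the first coordinate, hence also the second. In complex
  coordinates the symplectic form is a multiple of the standard area form, and antiderivatives
  exist although completeness of the plane is not part of its type.\<close>

lemma birkhoff_complex_coordinates:
  fixes x v :: "'a::real_normed_vector"
  assumes dim: "dim (UNIV :: 'a set) = 2" and \<omega>: "symplectic_form \<omega>"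
    and orth: "birkhoff_orthogonal x v" and x: "norm x = 1" and v: "v \<noteq> 0"
  obtains C :: "'a \<Rightarrow> complex" and L where "bounded_linear C" "bounded_linear L" "\<And>y. L (C y) = y"
    "\<And>y z. \<omega> y z = \<omega> x v * Im (cnj (C y) * C z)"
proof -
  note \<omega>_simps = symplectic_form_simps[OF \<omega>]
  have "x \<noteq> 0" using x by auto
  have nz: "\<omega> x v \<noteq> 0"
    using symplectic_form_birkhoff_nonzero[OF dim \<omega> orth \<open>x \<noteq> 0\<close> v] .
  define C where "C y = Complex (\<omega> y v / \<omega> x v) (\<omega> x y / \<omega> x v)" for y
  define L where "L z = Re z *\<^sub>R x + Im z *\<^sub>R v" for z
  have Cc: "C (a *\<^sub>R x + d *\<^sub>R v) = Complex a d" for a d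
    using nz by (simp add: C_def \<omega>_simps(1-5))
  have span: "\<exists>a d. y = a *\<^sub>R x + d *\<^sub>R v" for y
    using birkhoff_orthogonal_spans_plane[OF dim orth \<open>x \<noteq> 0\<close> v] by metis
  have bound: "norm (C y) \<le> norm y * (1 + 2 / norm v)" for y
  proof -
    obtain a d where y: "y = a *\<^sub>R x + d *\<^sub>R v" using span by blast
    have a: "\<bar>a\<bar> \<le> norm y"
    proof (cases "a = 0")
      case False
      have "\<bar>a\<bar> * 1 \<le> \<bar>a\<bar> * norm (x + (d / a) *\<^sub>R v)"
        using orth x unfolding birkhoff_orthogonal_def by (intro mult_left_mono) auto
      also have "\<dots> = norm (a *\<^sub>R (x + (d / a) *\<^sub>R v))" by simp
      also have "a *\<^sub>R (x + (d / a) *\<^sub>R v) = y" using False by (simp add: y algebra_simps)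
      finally show ?thesis by simp
    qed simp
    have "\<bar>d\<bar> * norm v = norm (y - a *\<^sub>R x)" by (simp add: y)
    also have "\<dots> \<le> norm y + \<bar>a\<bar>" using norm_triangle_ineq4[of y "a *\<^sub>R x"] x by simp
    finally have "\<bar>d\<bar> * norm v \<le> 2 * norm y" using a by simp
    then have d: "\<bar>d\<bar> \<le> 2 * norm y / norm v" using v by (simp add: field_simps)
    have "norm (C y) \<le> \<bar>a\<bar> + \<bar>d\<bar>" using cmod_le[of "C y"] by (simp add: y Cc)
    also have "\<dots> \<le> norm y * (1 + 2 / norm v)" using a d by (simp add: algebra_simps)
    finally show ?thesis .
  qed
  have "bounded_linear C"
    by (rule bounded_linear_intro[where K = "1 + 2 / norm v"])
       (use bound in \<open>auto simp: C_def complex_eq_iff \<omega>_simps(1-4) add_divide_distrib\<close>)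
  moreover have "bounded_linear L" unfolding L_def
    by (intro bounded_linear_add bounded_linear_scaleR_const bounded_linear_Re bounded_linear_Im)
  moreover have "L (C y) = y" for y
    using span[of y] by (auto simp: Cc L_def)
  moreover have "\<omega> y z = \<omega> x v * Im (cnj (C y) * C z)" for y z
  proof -
    obtain a d where "y = a *\<^sub>R x + d *\<^sub>R v" using span by blast
    moreover obtain a' d' where "z = a' *\<^sub>R x + d' *\<^sub>R v" using span by blast
    ultimately show ?thesis
      using \<omega>_simps(6)[of v x] by (simp add: Cc \<omega>_simps(1-5)) (simp add: algebra_simps)
  qed
  ultimately show ?thesis using that by blast
qed

section \<open>Radial projection onto a closed curve\<close>

text \<open>A smooth curve \<open>p\<close> that avoids the origin can be projected radially onto a smooth closed curve
  \<open>f\<close> that winds strictly around the origin, with smooth parameter \<open>m\<close> and smooth factor \<open>z\<close>.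
  The angular velocity of a plane curve \<open>p\<close> is \<open>Im (p' / p)\<close>; choosing \<open>m\<close> so that the angle
  of \<open>f\<close> at \<open>m t\<close> agrees with the angle of \<open>p\<close> at \<open>t\<close> only needs antiderivatives and the
  inverse of the angle of \<open>f\<close>. The quotient of two curves with equal angular velocity has real
  logarithmic derivative, so it keeps its initial, positive real direction.\<close>

lemma smooth_radial_lift:
  fixes f f' p :: "real \<Rightarrow> complex"
  assumes f: "smooth_map_on UNIV f" and f': "smooth_map_on UNIV f'"
    and deriv: "\<And>t. (f has_vector_derivative f' t) (at t)"
    and nz: "\<And>t. f t \<noteq> 0" and turns: "\<And>t. Im (f' t / f t) > 0"
    and T: "T > 0" "\<And>t. f (t + T) = f t" "\<And>t. f' (t + T) = f' t"
    and p: "smooth_map_on UNIV p" and p_nz: "\<And>t. p t \<noteq> 0"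
    and start: "p 0 = of_real r * f m\<^sub>0" "r > 0"
  obtains m z :: "real \<Rightarrow> real" where "smooth_map_on UNIV m" "smooth_map_on UNIV z"
    "\<And>t. z t > 0" "\<And>t. p t = of_real (z t) * f (m t)"
proof -
  have w: "smooth_map_on UNIV (\<lambda>t. Im (f' t / f t))"
    by (rule smooth_map_on_bounded_linear[OF bounded_linear_Im smooth_map_on_divide[OF f' f]])
       (rule nz)
  obtain \<Theta> where \<Theta>: "\<And>t. (\<Theta> has_vector_derivative Im (f' t / f t)) (at t)"
    by (rule smooth_antiderivative_UNIV[OF w]) blast
  obtain g where g: "smooth_map_on UNIV g" "\<And>t. \<Theta> (g t) = t" "\<And>t. g (\<Theta> t) = t"
      "\<And>t. (g has_vector_derivative inverse (Im (f' (g t) / f (g t)))) (at t)"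
    using smooth_inverse_of_periodic_derivative[OF w \<Theta> turns T(1)] T(2,3) by auto
  obtain p' where p': "smooth_map_on UNIV p'" "\<And>t. (p has_vector_derivative p' t) (at t)"
    using smooth_map_on_derivative[OF p] by auto
  have v: "smooth_map_on UNIV (\<lambda>t. Im (p' t / p t))"
    by (rule smooth_map_on_bounded_linear[OF bounded_linear_Im smooth_map_on_divide[OF p'(1) p]])
       (rule p_nz)
  obtain \<psi> where \<psi>: "smooth_map_on UNIV \<psi>"
      "\<And>t. (\<psi> has_vector_derivative Im (p' t / p t)) (at t)"
    by (rule smooth_antiderivative_UNIV[OF v]) blast
  \<comment> \<open>The angle of \<open>p\<close>, normalized to agree with the angle of \<open>f\<close> at
    \<open>m\<^sub>0\<close> when \<open>t = 0\<close>.\<close>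
  define \<beta> where "\<beta> t = \<psi> t - \<psi> 0 + \<Theta> m\<^sub>0" for t
  have d\<beta>: "(\<beta> has_vector_derivative Im (p' t / p t)) (at t)" for t
    unfolding \<beta>_def by (auto intro!: derivative_eq_intros \<psi>(2))
  have \<beta>: "smooth_map_on UNIV \<beta>"
    by (rule smooth_map_on_antiderivative[OF v]) (simp add: d\<beta>)
  define m where "m t = g (\<beta> t)" for t
  define q where "q t = f (m t)" for t
  have m: "smooth_map_on UNIV m"
    unfolding m_def by (rule smooth_map_on_compose[OF g(1) \<beta>])
  have "m 0 = m\<^sub>0" by (simp add: m_def \<beta>_def g(3))
  have q: "smooth_map_on UNIV q"
    unfolding q_def by (rule smooth_map_on_compose[OF f m])
  have q_nz: "q t \<noteq> 0" for t by (simp add: q_def nz)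
  define q' where "q' t = (Im (p' t / p t) / Im (f' (m t) / f (m t))) *\<^sub>R f' (m t)" for t
  have dq: "(q has_vector_derivative q' t) (at t)" for t
  proof -
    have "(g \<circ> \<beta> has_vector_derivative
        Im (p' t / p t) *\<^sub>R inverse (Im (f' (m t) / f (m t)))) (at t)"
      unfolding m_def by (rule vector_diff_chain_at[OF d\<beta> g(4)])
    then have "(m has_vector_derivative Im (p' t / p t) / Im (f' (m t) / f (m t))) (at t)"
      by (simp add: m_def[abs_def] o_def divide_inverse)
    then have "(f \<circ> m has_vector_derivative q' t) (at t)"
      unfolding q'_def by (rule vector_diff_chain_at[OF _ deriv])
    then show ?thesis by (simp add: q_def[abs_def] o_def)
  qed
  have same_rate: "Im (q' t / q t) = Im (p' t / p t)" for t
  proof -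
    have "q' t / q t = of_real (Im (p' t / p t) / Im (f' (m t) / f (m t))) * (f' (m t) / f (m t))"
      by (simp add: q'_def q_def scaleR_conv_of_real)
    moreover have "Im (of_real k * y) = k * Im y" for k y by simp
    ultimately show ?thesis using turns[of "m t"] by (metis less_irrefl nonzero_eq_divide_eq)
  qed
  define Z where "Z t = p t / q t" for t
  have Z: "smooth_map_on UNIV Z"
    unfolding Z_def by (rule smooth_map_on_divide[OF p q q_nz])
  obtain Z' where Z': "\<And>t. (Z has_vector_derivative Z' t) (at t)"
    using smooth_map_on_derivative[OF Z] by auto
  define \<rho> where "\<rho> t = Re (p' t / p t - q' t / q t)" for t
  have Z_ode: "Z' t = of_real (\<rho> t) * Z t" for t
  proof -
    have "((\<lambda>t. Z t * q t) has_vector_derivative Z t * q' t + Z' t * q t) (at t)"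
      by (rule has_vector_derivative_mult[OF Z' dq])
    moreover have "(\<lambda>t. Z t * q t) = p" by (simp add: Z_def q_nz)
    ultimately have "p' t = Z t * q' t + Z' t * q t"
      using vector_derivative_unique_at[OF p'(2)[of t]] by simp
    then have "Z' t = (p' t - Z t * q' t) / q t" using q_nz[of t] by (simp add: field_simps)
    also have "\<dots> = (p' t / p t - q' t / q t) * Z t"
      using q_nz[of t] p_nz[of t] by (simp add: Z_def field_simps)
    also have "p' t / p t - q' t / q t = of_real (\<rho> t)"
      using same_rate[of t] by (simp add: \<rho>_def complex_eq_iff)
    finally show ?thesis .
  qed
  have "smooth_map_on UNIV \<rho>"
  proof -
    obtain q'' where q'': "smooth_map_on UNIV q''" "\<And>t. (q has_vector_derivative q'' t) (at t)"
      using smooth_map_on_derivative[OF q] by auto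
    have "q'' = q'" using vector_derivative_unique_at[OF q''(2) dq] by (simp add: fun_eq_iff)
    then have "smooth_map_on UNIV q'" using q''(1) by simp
    then have "smooth_map_on UNIV (\<lambda>t. Re (p' t / p t) + (-1) * Re (q' t / q t))"
      by (intro smooth_map_on_add smooth_map_on_mult smooth_map_on_const
          smooth_map_on_bounded_linear[OF bounded_linear_Re] smooth_map_on_divide p'(1) p q p_nz q_nz)
    then show ?thesis by (simp add: \<rho>_def[abs_def])
  qed
  then obtain \<Lambda> where \<Lambda>: "\<And>t. (\<Lambda> has_vector_derivative \<rho> t) (at t)"
    using smooth_antiderivative_UNIV by blast
  \<comment> \<open>Integrating factor for \<open>Z' = \<rho> Z\<close>.\<close>
  have "((\<lambda>t. exp (- \<Lambda> t) *\<^sub>R Z t) has_vector_derivative 0) (at t)" for t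
  proof -
    have "(\<Lambda> has_real_derivative \<rho> t) (at t)"
      using \<Lambda> by (simp add: has_real_derivative_iff_has_vector_derivative)
    then have "((\<lambda>t. exp (- \<Lambda> t)) has_real_derivative exp (- \<Lambda> t) * - \<rho> t) (at t)"
      by (auto intro!: derivative_eq_intros)
    then have "((\<lambda>t. exp (- \<Lambda> t) *\<^sub>R Z t) has_vector_derivative
        exp (- \<Lambda> t) *\<^sub>R Z' t + (exp (- \<Lambda> t) * - \<rho> t) *\<^sub>R Z t) (at t)"
      by (rule has_vector_derivative_scaleR[OF _ Z'])
    then show ?thesis by (simp add: Z_ode scaleR_conv_of_real)
  qed
  then obtain k where k: "\<And>t. exp (- \<Lambda> t) *\<^sub>R Z t = k"
    using has_vector_derivative_zero_constant[OF convex_UNIV, of "\<lambda>t. exp (- \<Lambda> t) *\<^sub>R Z t"] by auto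
  have "Z 0 = of_real r" using start nz \<open>m 0 = m\<^sub>0\<close> by (simp add: Z_def q_def)
  then have "k = of_real (exp (- \<Lambda> 0) * r)" using k[of 0] by (simp add: scaleR_conv_of_real)
  moreover have "Z t = exp (\<Lambda> t) *\<^sub>R k" for t
    by (simp add: k[of t, symmetric] exp_minus)
  ultimately have Zt: "Z t = of_real (exp (\<Lambda> t) * exp (- \<Lambda> 0) * r)" for t
    by (simp add: scaleR_conv_of_real)
  show ?thesis
  proof (rule that[of m "\<lambda>t. Re (Z t)"])
    show "smooth_map_on UNIV m" by (rule m)
    show "smooth_map_on UNIV (\<lambda>t. Re (Z t))"
      by (rule smooth_map_on_bounded_linear[OF bounded_linear_Re Z])
    show "Re (Z t) > 0" for t using start(2) by (simp only: Zt Re_complex_of_real) simp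
    have "of_real (Re (Z t)) = Z t" for t by (simp only: Zt Re_complex_of_real)
    then show "p t = of_real (Re (Z t)) * f (m t)" for t
      using q_nz[of t] by (simp add: Z_def q_def)
  qed
qed

section \<open>Legendre curves with prescribed curvature\<close>

text \<open>Image and injectivity are prescribed on one period only; periodicity extends the image
  statement to the whole line and passes to the derivative.\<close>

lemma smooth_closed_curve_periodic:
  assumes "smooth_closed_curve K"
  obtains T \<phi> \<phi>' where "T > 0" "smooth_map_on UNIV \<phi>" "smooth_map_on UNIV \<phi>'"
    "\<And>u. (\<phi> has_vector_derivative \<phi>' u) (at u)" "\<And>u. \<phi>' u \<noteq> 0"
    "\<And>u. \<phi> (u + T) = \<phi> u" "\<And>u. \<phi>' (u + T) = \<phi>' u" "range \<phi> = K"
proof -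
  obtain T \<phi> where T: "T > 0" and \<phi>: "smooth_map_on UNIV \<phi>"
    and nz: "\<And>u. vector_derivative \<phi> (at u) \<noteq> 0" and per: "\<And>u. \<phi> (u + T) = \<phi> u"
    and img: "\<phi> ` {0..<T} = K"
    using assms unfolding smooth_closed_curve_def by auto
  obtain \<phi>' where \<phi>': "smooth_map_on UNIV \<phi>'" "\<And>u. (\<phi> has_vector_derivative \<phi>' u) (at u)"
    using smooth_map_on_derivative[OF \<phi>] by auto
  have "\<phi>' u \<noteq> 0" for u
    using nz[of u] vector_derivative_at[OF \<phi>'(2)[of u]] by simp
  moreover have "\<phi>' (u + T) = \<phi>' u" for u
  proof -
    have "(\<phi> \<circ> (\<lambda>u. u + T) has_vector_derivative 1 *\<^sub>R \<phi>' (u + T)) (at u)"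
      by (rule vector_diff_chain_at[OF _ \<phi>'(2)]) (auto intro!: derivative_eq_intros)
    then have "(\<phi> has_vector_derivative \<phi>' (u + T)) (at u)" by (simp add: o_def per)
    then show ?thesis using \<phi>'(2) by (rule vector_derivative_unique_at)
  qed
  moreover have "range \<phi> = K"
  proof -
    interpret periodic_fun_simple \<phi> T by unfold_locales (rule per)
    have "\<phi> u \<in> \<phi> ` {0..<T}" for u
    proof -
      define u\<^sub>0 where "u\<^sub>0 = u - of_int \<lfloor>u / T\<rfloor> * T"
      have "of_int \<lfloor>u / T\<rfloor> * T \<le> u" "u < (of_int \<lfloor>u / T\<rfloor> + 1) * T"
        using T by (simp_all add: pos_le_divide_eq[symmetric] pos_divide_less_eq[symmetric])
      then have "u\<^sub>0 \<in> {0..<T}" by (simp add: u\<^sub>0_def algebra_simps)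
      moreover have "\<phi> u\<^sub>0 = \<phi> u" by (simp add: u\<^sub>0_def minus_of_int)
      ultimately show ?thesis by (metis imageI)
    qed
    then show ?thesis using img by blast
  qed
  ultimately show ?thesis using that T \<phi> \<phi>' per by blast
qed

text \<open>The form does not vanish on a point of the circle and its tangent, so running through the circle
  backwards, if necessary, makes the orientation positive.\<close>

lemma oriented_unit_circle_parametrization:
  fixes \<omega> :: "'a::real_normed_vector \<Rightarrow> 'a \<Rightarrow> real"
  assumes dim: "dim (UNIV :: 'a set) = 2" and smooth: "smooth_plane TYPE('a)"
    and \<omega>: "symplectic_form \<omega>"
  obtains T and \<phi> \<phi>' :: "real \<Rightarrow> 'a" where "T > 0" "smooth_map_on UNIV \<phi>" "smooth_map_on UNIV \<phi>'"
    "\<And>u. (\<phi> has_vector_derivative \<phi>' u) (at u)" "\<And>u. \<phi>' u \<noteq> 0"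
    "\<And>u. \<phi> (u + T) = \<phi> u" "\<And>u. \<phi>' (u + T) = \<phi>' u" "range \<phi> = unit_circle"
    "\<omega> (\<phi> 0) (\<phi>' 0) > 0"
proof -
  obtain T and \<phi> \<phi>' :: "real \<Rightarrow> 'a" where *: "T > 0" "smooth_map_on UNIV \<phi>" "smooth_map_on UNIV \<phi>'"
    "\<And>u. (\<phi> has_vector_derivative \<phi>' u) (at u)" "\<And>u. \<phi>' u \<noteq> 0"
    "\<And>u. \<phi> (u + T) = \<phi> u" "\<And>u. \<phi>' (u + T) = \<phi>' u" "range \<phi> = unit_circle"
    by (rule smooth_closed_curve_periodic[OF smooth[unfolded smooth_plane_def]]) blast
  have unit: "norm (\<phi> u) = 1" for u using *(8) by auto
  have "\<omega> (\<phi> 0) (\<phi>' 0) \<noteq> 0"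
    by (rule symplectic_form_birkhoff_nonzero[OF dim \<omega> birkhoff_orthogonal_tangent[OF unit *(4)] _ *(5)])
       (use unit[of 0] in auto)
  then consider "\<omega> (\<phi> 0) (\<phi>' 0) > 0" | "\<omega> (\<phi> 0) (\<phi>' 0) < 0" by linarith
  then show ?thesis
  proof cases
    case 1
    then show ?thesis using that * by blast
  next
    case 2
    show ?thesis
    proof (rule that[of T "\<lambda>u. \<phi> (- u)" "\<lambda>u. - \<phi>' (- u)"])
      show "smooth_map_on UNIV (\<lambda>u. \<phi> (- u))"
        by (rule smooth_map_on_reflect[OF *(2)])
      show "smooth_map_on UNIV (\<lambda>u. - \<phi>' (- u))"
        by (rule smooth_map_on_bounded_linear[OF bounded_linear_minus[OF bounded_linear_ident]
              smooth_map_on_reflect[OF *(3)]])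
      show "((\<lambda>u. \<phi> (- u)) has_vector_derivative - \<phi>' (- u)) (at u)" for u
      proof -
        have "(\<phi> \<circ> uminus has_vector_derivative (-1) *\<^sub>R \<phi>' (- u)) (at u)"
          by (rule vector_diff_chain_at[OF _ *(4)]) (auto intro!: derivative_eq_intros)
        then show ?thesis by (simp add: o_def)
      qed
      show "\<phi> (- (u + T)) = \<phi> (- u)" for u using *(6)[of "- u - T"] by simp
      show "- \<phi>' (- (u + T)) = - \<phi>' (- u)" for u using *(7)[of "- u - T"] by simp
      show "range (\<lambda>u. \<phi> (- u)) = unit_circle"
        using *(8) surj_uminus[where 'a = real] by (metis image_image)
      show "0 < \<omega> (\<phi> (- 0)) (- \<phi>' (- 0))"
        using 2 symplectic_form_simps(4)[OF \<omega>, of "\<phi> 0" "-1" "\<phi>' 0"] by simp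
    qed (use * in auto)
  qed
qed

lemma continuous_nonzero_imp_pos:
  fixes a :: "real \<Rightarrow> real"
  assumes "continuous_on UNIV a" "\<And>u. a u \<noteq> 0" "a 0 > 0"
  shows "a u > 0"
proof (rule ccontr)
  assume "\<not> a u > 0"
  moreover have "connected (range a)"
    by (rule connected_continuous_image[OF assms(1) connected_UNIV])
  ultimately have "0 \<in> range a"
    unfolding connected_iff_interval using assms(3) by (meson less_imp_le not_less rangeI)
  then show False using assms(2) by (metis rangeE)
qed

theorem theorem3p1:
  fixes \<omega> :: "'a::real_normed_vector \<Rightarrow> 'a \<Rightarrow> real"
    and c :: real and \<alpha> \<kappa> :: "real \<Rightarrow> real"
  assumes "dim (UNIV :: 'a set) = 2"
    and "smooth_plane TYPE('a)"
    and "strictly_convex_plane TYPE('a)"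
    and "symplectic_form \<omega>"
    and "c > 0"
    and "smooth_map_on {0..c} (\<lambda>t. (\<alpha> t, \<kappa> t))"
  shows "\<exists>\<gamma> \<eta> :: real \<Rightarrow> 'a.
           legendre_curve {0..c} \<gamma> \<eta> \<and> has_curvature \<omega> {0..c} \<gamma> \<eta> \<alpha> \<kappa>"
proof -
  note dim = assms(1) and \<omega> = assms(4)
  have \<alpha>: "smooth_map_on {0..c} \<alpha>"
    using smooth_map_on_bounded_linear[OF bounded_linear_fst assms(6)] by simp
  have \<kappa>: "smooth_map_on {0..c} \<kappa>"
    using smooth_map_on_bounded_linear[OF bounded_linear_snd assms(6)] by simp
  obtain T and \<phi> \<phi>' :: "real \<Rightarrow> 'a" where T: "T > 0"
    and \<phi>: "smooth_map_on UNIV \<phi>" and \<phi>': "smooth_map_on UNIV \<phi>'"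
    and deriv: "\<And>u. (\<phi> has_vector_derivative \<phi>' u) (at u)" and nz: "\<And>u. \<phi>' u \<noteq> 0"
    and per: "\<And>u. \<phi> (u + T) = \<phi> u" "\<And>u. \<phi>' (u + T) = \<phi>' u"
    and range: "range \<phi> = unit_circle" and pos0: "\<omega> (\<phi> 0) (\<phi>' 0) > 0"
    by (rule oriented_unit_circle_parametrization[OF dim assms(2) \<omega>]) blast
  have unit: "norm (\<phi> u) = 1" for u using range by auto
  then have \<phi>_nz: "\<phi> u \<noteq> 0" for u by (metis norm_zero zero_neq_one)
  have orth: "birkhoff_orthogonal (\<phi> u) (\<phi>' u)" for u
    by (rule birkhoff_orthogonal_tangent[OF unit deriv])
  obtain C :: "'a \<Rightarrow> complex" and L where C: "bounded_linear C" and L: "bounded_linear L"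
    and LC: "\<And>y. L (C y) = y"
    and \<omega>C: "\<And>y z. \<omega> y z = \<omega> (\<phi> 0) (\<phi>' 0) * Im (cnj (C y) * C z)"
    using birkhoff_complex_coordinates[OF dim \<omega> orth[of 0] unit nz] by blast
  interpret C: bounded_linear C by (rule C)
  interpret L: bounded_linear L by (rule L)
  define f where "f u = C (\<phi> u)" for u
  define f' where "f' u = C (\<phi>' u)" for u
  have f: "smooth_map_on UNIV f" "smooth_map_on UNIV f'"
    unfolding f_def f'_def by (rule smooth_map_on_bounded_linear[OF C] \<phi> \<phi>')+
  have df: "(f has_vector_derivative f' u) (at u)" for u
    unfolding f_def f'_def by (rule C.has_vector_derivative[OF deriv])
  have C_nz: "C y \<noteq> 0" if "y \<noteq> 0" for y using that LC[of y] L.zero by metis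
  have area: "\<omega> (\<phi> u) (\<phi>' u) = \<omega> (\<phi> 0) (\<phi>' 0) * Im (cnj (f u) * f' u)" for u
    unfolding f_def f'_def by (rule \<omega>C)
  have area_pos: "\<omega> (\<phi> u) (\<phi>' u) > 0" for u
  proof (rule continuous_nonzero_imp_pos[of "\<lambda>u. \<omega> (\<phi> u) (\<phi>' u)"])
    have "continuous_on UNIV (\<lambda>u. \<omega> (\<phi> 0) (\<phi>' 0) * Im (cnj (f u) * f' u))"
      by (intro continuous_intros smooth_map_on_imp_continuous_on f)
    also have "(\<lambda>u. \<omega> (\<phi> 0) (\<phi>' 0) * Im (cnj (f u) * f' u)) = (\<lambda>u. \<omega> (\<phi> u) (\<phi>' u))"
      by (rule ext) (rule area[symmetric])
    finally show "continuous_on UNIV (\<lambda>u. \<omega> (\<phi> u) (\<phi>' u))" .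
    show "\<omega> (\<phi> u) (\<phi>' u) \<noteq> 0" for u
      by (rule symplectic_form_birkhoff_nonzero[OF dim \<omega> orth \<phi>_nz nz])
  qed (rule pos0)
  have turns: "Im (f' u / f u) > 0" for u
  proof -
    have "Im (cnj (f u) * f' u) > 0"
      using area_pos[of u] pos0 area[of u] by (metis zero_less_mult_pos)
    then show ?thesis by (simp add: Im_complex_div_gt_0 mult.commute)
  qed
  \<comment> \<open>The derivative of \<open>\<phi>\<close> is projected back onto the circle: \<open>\<phi>'
    = z \<phi>(m)\<close> exhibits both the speed \<open>z\<close> and the vector \<open>b(\<phi>) =
    \<phi>(m)\<close> as smooth functions of the parameter.\<close>
  have "(1 / norm (\<phi>' 0)) *\<^sub>R \<phi>' 0 \<in> range \<phi>" using nz by (simp add: range)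
  then obtain m\<^sub>0 where "\<phi> m\<^sub>0 = (1 / norm (\<phi>' 0)) *\<^sub>R \<phi>' 0" by (metis rangeE)
  then have start: "f' 0 = of_real (norm (\<phi>' 0)) * f m\<^sub>0"
    using nz[of 0] by (simp add: f_def f'_def C.scaleR scaleR_conv_of_real)
  obtain m z where m: "smooth_map_on UNIV m" and z: "smooth_map_on UNIV z" "\<And>u. z u > 0"
    and zm: "\<And>u. f' u = of_real (z u) * f (m u)"
    by (rule smooth_radial_lift[OF f df _ turns T _ _ f(2) _ start])
       (use C_nz \<phi>_nz nz per in \<open>auto simp: f_def f'_def\<close>)
  have \<phi>'_eq: "\<phi>' u = z u *\<^sub>R \<phi> (m u)" for u
    using arg_cong[OF zm[of u], of L] LC
    by (simp add: f_def f'_def scaleR_conv_of_real[symmetric] L.scaleR)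
  then have z_eq: "norm (\<phi>' u) = z u" for u using z(2)[of u] by (simp add: unit)
  have b: "birkhoff_b \<omega> (\<phi> u) = \<phi> (m u)" for u
    using birkhoff_b_eq_unit_tangent[OF dim \<omega> unit deriv area_pos] z(2)[of u]
    by (simp add: z_eq) (simp add: \<phi>'_eq)
  have z_per: "z (u + T) = z u" for u by (simp add: z_eq[symmetric] per)
  \<comment> \<open>The arc length \<open>\<sigma>\<close> of the circle turns \<open>\<eta>' = \<kappa>
    b(\<eta>)\<close> into \<open>(\<sigma>(\<theta>))' = \<kappa>\<close> for \<open>\<eta> =
    \<phi>(\<theta>)\<close>, which is solved by integrating \<open>\<kappa>\<close> and inverting
    \<open>\<sigma>\<close>.\<close>
  obtain \<sigma> where \<sigma>: "\<And>u. (\<sigma> has_vector_derivative z u) (at u)"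
    using smooth_antiderivative_UNIV[OF z(1)] by blast
  obtain g where g: "smooth_map_on UNIV g" "\<And>s. (g has_vector_derivative inverse (z (g s))) (at s)"
    using smooth_inverse_of_periodic_derivative[OF z(1) \<sigma> z(2) T z_per] by metis
  obtain K where K: "smooth_map_on {0..c} K"
      "\<And>t. t \<in> {0..c} \<Longrightarrow> (K has_vector_derivative \<kappa> t) (at t within {0..c})"
    using smooth_antiderivative_Icc[OF \<kappa>] by blast
  define \<theta> where "\<theta> t = g (K t)" for t
  have \<theta>: "smooth_map_on {0..c} \<theta>"
    unfolding \<theta>_def by (rule smooth_map_on_compose[OF g(1) K(1)])
  have d\<theta>: "(\<theta> has_vector_derivative \<kappa> t / z (\<theta> t)) (at t within {0..c})" if "t \<in> {0..c}" for t
    using vector_diff_chain_within[OF K(2)[OF that] has_vector_derivative_at_within[OF g(2)]]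
    by (simp add: \<theta>_def[abs_def] o_def divide_inverse)
  define \<eta> where "\<eta> t = \<phi> (\<theta> t)" for t
  have \<eta>: "smooth_map_on {0..c} \<eta>"
    using smooth_map_on_bounded_linear[OF L smooth_map_on_compose[OF f(1) \<theta>]]
    by (simp add: f_def LC \<eta>_def[abs_def])
  have d\<eta>: "(\<eta> has_vector_derivative \<kappa> t *\<^sub>R birkhoff_b \<omega> (\<eta> t)) (at t within {0..c})"
    if "t \<in> {0..c}" for t
    using vector_diff_chain_within[OF d\<theta>[OF that] has_vector_derivative_at_within[OF deriv]] z(2)[of "\<theta> t"]
    by (simp add: \<eta>_def[abs_def] o_def b \<phi>'_eq)
  \<comment> \<open>With \<open>\<eta>\<close> known, \<open>\<gamma>' = \<alpha> b(\<eta>)\<close> is a plain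
    antiderivative, taken in coordinates.\<close>
  have "smooth_map_on {0..c} (\<lambda>t. of_real (\<alpha> t) * f (m (\<theta> t)))"
    by (intro smooth_map_on_mult smooth_map_on_bounded_linear[OF bounded_linear_of_real \<alpha>]
        smooth_map_on_compose[OF f(1)] smooth_map_on_compose[OF m] \<theta>)
  then obtain G where G: "smooth_map_on {0..c} G"
      "\<And>t. t \<in> {0..c} \<Longrightarrow> (G has_vector_derivative of_real (\<alpha> t) * f (m (\<theta> t))) (at t within {0..c})"
    using smooth_antiderivative_Icc by blast
  define \<gamma> where "\<gamma> t = L (G t)" for t
  have \<gamma>: "smooth_map_on {0..c} \<gamma>"
    unfolding \<gamma>_def by (rule smooth_map_on_bounded_linear[OF L G(1)])
  have d\<gamma>: "(\<gamma> has_vector_derivative \<alpha> t *\<^sub>R birkhoff_b \<omega> (\<eta> t)) (at t within {0..c})"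
    if "t \<in> {0..c}" for t
    using L.has_vector_derivative[OF G(2)[OF that]]
    by (simp add: \<gamma>_def[abs_def] scaleR_conv_of_real[symmetric] L.scaleR f_def LC \<eta>_def b)
  have "birkhoff_orthogonal (\<eta> t) (vector_derivative \<gamma> (at t within {0..c}))" if "t \<in> {0..c}" for t
  proof -
    have "vector_derivative \<gamma> (at t within {0..c}) = \<alpha> t *\<^sub>R birkhoff_b \<omega> (\<eta> t)"
      using vector_derivative_within_cbox[of 0 c t] assms(5) that d\<gamma>[OF that] by simp
    also have "\<dots> = (\<alpha> t / z (\<theta> t)) *\<^sub>R \<phi>' (\<theta> t)"
      using z(2)[of "\<theta> t"] by (simp add: \<eta>_def b \<phi>'_eq)
    finally show ?thesis
      using birkhoff_orthogonal_scaleR[OF orth] by (simp add: \<eta>_def)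
  qed
  then have "legendre_curve {0..c} \<gamma> \<eta>"
    unfolding legendre_curve_def
    using smooth_map_on_Pair[OF \<gamma> \<eta>] unit by (simp add: \<eta>_def)
  moreover have "has_curvature \<omega> {0..c} \<gamma> \<eta> \<alpha> \<kappa>"
    unfolding has_curvature_def using d\<gamma> d\<eta> by blast
  ultimately show ?thesis by blast
qed

end
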